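(* Let $k\ge 2$ be an integer and $\varepsilon\in(0,1)$. Let $X_1,\dots,X_k,D\in[1,\infty)$ with $D\le\min(X_1,\dots,X_k)$, let $\delta\in(0,1]$, and let $A_i\subset[X_i,2X_i]$ ($1\le i\le k$) be sets of integers such that $\gcd(a_1,\dots,a_k)\ge D$ for at least $\delta\prod_{i=1}^k|A_i|$ tuples $(a_1,\dots,a_k)\in\prod_{i=1}^kA_i$. Then $$\prod_{i=1}^k|A_i|\ll_{k,\varepsilon}\delta^{-\frac{k}{k-1}}\,\frac{\prod_{i=1}^kX_i}{D^{k-\varepsilon}},$$ where the implied constant depends only on $k$ and $\varepsilon$. *)

theory Defs
  imports Complex_Main "HOL-Library.FuncSet"
begin

end

theory Submission
  imports Defs "HOL-Analysis.Convex" "HOL-Analysis.Summation_Tests"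
begin

text \<open>
  The proof is a multilinear Schur test. Fix \<open>e > 0\<close> and let \<open>W\<close> be the positive function with
  \<open>W(n) = (\<Sum>d dvd n. d powr -e * W(d))\<close>, \<open>W(1) = 1\<close>. It is submultiplicative and has bounded mean values,
  so \<open>W(b) powr r\<close> with \<open>r \<le> 1\<close> sums to \<open>O(Y / d * W(d) powr r)\<close> over the multiples \<open>b \<le> Y\<close> of \<open>d\<close>.
  Put \<open>n = k - 1\<close>. On the set \<open>E\<close> of tuples with gcd at least \<open>D\<close>, the indicator is at most the sum of
  \<open>(d / D) powr (n - e)\<close> over the common divisors \<open>d\<close>. Give the entry \<open>a_i\<close> the weight \<open>1 / W(a_i)\<close> and every other
  entry \<open>a_j\<close> the weight \<open>W(a_j) powr (1 / n)\<close>: after summing over the \<open>a_j\<close>, the remaining sum over \<open>d dvd a_i\<close>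
  is exactly \<open>W(a_i)\<close>, so the weighted count of \<open>E\<close> is
  \<open>O(D powr (e - n) * |A_i| * (\<Prod>j \<noteq> i. X_j))\<close>. The product of these weights over all \<open>i\<close> is \<open>1\<close>, so AM-GM bounds \<open>|E| ^ k\<close>
  by the product of the \<open>k\<close> weighted counts; the choice \<open>e = \<epsilon> * n / k\<close> gives the theorem.
\<close>

section \<open>The divisor weight: recursion, positivity and submultiplicativity\<close>

text \<open>The recursion is the identity \<open>divisor_weight_sum\<close> below, solved for the term \<open>d = n\<close>.\<close>
function divisor_weight :: "real \<Rightarrow> nat \<Rightarrow> real" where
  "divisor_weight e n =
    (if n \<le> 1 then 1
     else (\<Sum>d | d dvd n \<and> d < n. real d powr -e * divisor_weight e d) / (1 - real n powr -e))"
  by auto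
termination by (relation "Wellfounded.measure snd") auto

declare divisor_weight.simps [simp del]

lemma divisor_weight_1 [simp]: "divisor_weight e (Suc 0) = 1"
  by (simp add: divisor_weight.simps)

lemma powr_minus_less_1:
  assumes "0 < e" "1 < n"
  shows "real n powr -e < 1"
  using assms powr_less_mono[of "-e" 0 "real n"] by simp

lemma divisor_weight_proper:
  assumes "0 < e" "1 < n"
  shows "(1 - real n powr -e) * divisor_weight e n
    = (\<Sum>d | d dvd n \<and> d < n. real d powr -e * divisor_weight e d)"
  using assms powr_minus_less_1[OF assms] by (subst divisor_weight.simps) simp

lemma divisor_weight_sum:
  assumes "0 < e" "0 < n"
  shows "(\<Sum>d | d dvd n. real d powr -e * divisor_weight e d) = divisor_weight e n"
proof (cases "n = 1")
  case False
  with assms have n: "1 < n" by simp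
  have eq: "{d. d dvd n} = insert n {d. d dvd n \<and> d < n}"
    using n by (auto dest: dvd_imp_le)
  show ?thesis
    unfolding eq using divisor_weight_proper[OF assms(1) n]
    by (subst sum.insert) (auto simp: algebra_simps)
qed simp

text \<open>The divisor 1 alone contributes 1 to the recursion, and the factor
  \<open>1 - real n powr -e\<close> lies in (0, 1], so dividing by it cannot decrease the
  sum.\<close>

lemma divisor_weight_ge_1:
  assumes "0 < e" "0 < n"
  shows "1 \<le> divisor_weight e n"
  using assms(2)
proof (induction n rule: less_induct)
  case (less n)
  show ?case
  proof (cases "n = 1")
    case False
    with less have n: "1 < n" by simp
    have nn: "0 \<le> divisor_weight e d" if "d dvd n" "d < n" for d
      using less.IH[of d] that n by (cases "d = 0") auto
    have "1 = (\<Sum>d\<in>{1}. real d powr -e * divisor_weight e d)" by simp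
    also have "\<dots> \<le> (\<Sum>d | d dvd n \<and> d < n. real d powr -e * divisor_weight e d)"
      using n nn by (intro sum_mono2) auto
    also have "\<dots> = (1 - real n powr -e) * divisor_weight e n"
      using divisor_weight_proper[OF assms(1) n] by simp
    finally have *: "1 \<le> (1 - real n powr -e) * divisor_weight e n" .
    moreover have "0 < 1 - real n powr -e" "1 - real n powr -e \<le> 1"
      using powr_minus_less_1[OF assms(1) n] by auto
    moreover from * this have "0 < divisor_weight e n"
      by (metis linorder_not_less mult_nonneg_nonpos not_one_le_zero order_trans less_imp_le)
    ultimately show ?thesis
      by (smt (verit) mult_left_le_one_le)
  qed simp
qed

text \<open>Every proper divisor of \<open>a * b\<close> is \<open>u * v\<close> for divisors \<open>(u, v) \<noteq> (a, b)\<close> of \<open>a\<close> and \<open>b\<close>, so by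
  induction the recursion for \<open>a * b\<close> is dominated by the product of the two divisor sums without
  its last term.\<close>
lemma divisor_weight_mult_le:
  assumes "0 < e" "0 < a" "0 < b"
  shows "divisor_weight e (a * b) \<le> divisor_weight e a * divisor_weight e b"
  using assms(2,3)
proof (induction "a * b" arbitrary: a b rule: less_induct)
  case less
  define h where "h n = real n powr -e * divisor_weight e n" for n
  have h0: "0 \<le> h n" if "0 < n" for n
    using divisor_weight_ge_1[OF assms(1) that] by (simp add: h_def)
  show ?case
  proof (cases "a * b = 1")
    case False
    with less have n: "1 < a * b"
      by (metis One_nat_def Suc_lessI nat_0_less_mult_iff)
    let ?P = "{d. d dvd a} \<times> {d. d dvd b}"
    let ?I = "?P - {(a, b)}"
    have finP: "finite ?P" using less by simp
    have bound: "0 < u \<and> 0 < v \<and> u * v < a * b" if "(u, v) \<in> ?I" for u v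
    proof -
      have "u \<le> a" "v \<le> b" "u \<noteq> a \<or> v \<noteq> b" "0 < u" "0 < v"
        using that less(2,3) by (auto dest: dvd_imp_le intro: Nat.gr0I)
      thus ?thesis
        using mult_less_le_imp_less[of u a v b] mult_le_less_imp_less[of u a v b] by auto
    qed
    have "(\<Sum>d | d dvd a * b \<and> d < a * b. h d) \<le> sum h ((\<lambda>(u, v). u * v) ` ?I)"
    proof (rule sum_mono2)
      show "{d. d dvd a * b \<and> d < a * b} \<subseteq> (\<lambda>(u, v). u * v) ` ?I"
      proof
        fix d assume "d \<in> {d. d dvd a * b \<and> d < a * b}"
        hence d: "d dvd a * b" "d < a * b" by auto
        then obtain u v where "d = u * v" "u dvd a" "v dvd b" by (elim dvd_productE)
        with d show "d \<in> (\<lambda>(u, v). u * v) ` ?I"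
          by (intro image_eqI[of _ _ "(u, v)"]) auto
      qed
    next
      show "finite ((\<lambda>(u, v). u * v) ` ?I)" by (intro finite_imageI finite_Diff finP)
    next
      fix d assume "d \<in> (\<lambda>(u, v). u * v) ` ?I - {d. d dvd a * b \<and> d < a * b}"
      from DiffD1[OF this] obtain p where p: "d = fst p * snd p" "p \<in> ?I"
        unfolding case_prod_unfold by (rule imageE)
      have "0 < d" using bound[of "fst p" "snd p"] p by (simp only: prod.collapse nat_0_less_mult_iff)
      thus "0 \<le> h d" by (rule h0)
    qed
    \<comment> \<open>Different pairs can have the same product; as \<open>h\<close> is nonnegative
      at positive arguments, counting them separately only enlarges the sum.\<close>
    also have "\<dots> \<le> sum (h \<circ> (\<lambda>(u, v). u * v)) ?I"
    proof (rule sum_image_le)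
      show "finite ?I" by (intro finite_Diff finP)
      fix i assume "i \<in> ?I"
      hence "0 < fst i * snd i"
        using bound[of "fst i" "snd i"] by (simp only: prod.collapse nat_0_less_mult_iff)
      thus "0 \<le> h (case i of (u, v) \<Rightarrow> u * v)"
        unfolding case_prod_unfold by (rule h0)
    qed
    also have "\<dots> = (\<Sum>(u, v)\<in>?I. h (u * v))"
      by (simp add: comp_def case_prod_unfold)
    also have "\<dots> \<le> (\<Sum>(u, v)\<in>?I. h u * h v)"
    proof (rule sum_mono)
      fix p assume p: "p \<in> ?I"
      obtain u v where uv: "p = (u, v)" by (cases p)
      hence "0 < u" "0 < v" "u * v < a * b" using bound[of u v] p by auto
      with less(1) have le: "divisor_weight e (u * v) \<le> divisor_weight e u * divisor_weight e v"
        by blast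
      thus "(case p of (u, v) \<Rightarrow> h (u * v)) \<le> (case p of (u, v) \<Rightarrow> h u * h v)"
        using mult_left_mono[OF le, of "real u powr -e * real v powr -e"]
        unfolding h_def uv by (simp add: powr_mult mult_ac)
    qed
    also have "\<dots> = (\<Sum>(u, v)\<in>?P. h u * h v) - h a * h b"
      using finP by (subst sum_diff1) auto
    also have "(\<Sum>(u, v)\<in>?P. h u * h v) = divisor_weight e a * divisor_weight e b"
      using divisor_weight_sum[OF assms(1), of a] divisor_weight_sum[OF assms(1), of b] less
      by (simp add: sum.cartesian_product[symmetric] sum_product[symmetric] h_def)
    \<comment> \<open>The omitted pair \<open>(a, b)\<close> is the share
      \<open>real (a * b) powr -e\<close> of the full product, so what remains carries the same
      factor as the recursion at \<open>a * b\<close>, and that factor cancels.\<close>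
    also have "divisor_weight e a * divisor_weight e b - h a * h b
        = (1 - real (a * b) powr -e) * (divisor_weight e a * divisor_weight e b)"
      by (simp add: h_def powr_mult algebra_simps)
    finally have "(1 - real (a * b) powr -e) * divisor_weight e (a * b)
        \<le> (1 - real (a * b) powr -e) * (divisor_weight e a * divisor_weight e b)"
      using divisor_weight_proper[OF assms(1) n] by (simp add: h_def)
    thus ?thesis
      using powr_minus_less_1[OF assms(1) n] by simp
  qed simp
qed

section \<open>Polynomial growth of the weight\<close>

lemma sum_inverse_squares_le_1: "(\<Sum>x=2..n. real x powr -2) \<le> 1"
proof (cases "n = 0")
  case False
  have "(\<Sum>x=2..n. real x powr -2) \<le> 1 - 1 / real n" if "n > 0"
    using that
  proof (induction n rule: nat_induct_non_zero)
    case (Suc n)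
    have "real (Suc n) powr -2 = 1 / (real (Suc n))\<^sup>2"
      by (simp add: powr_minus divide_simps)
    also have "\<dots> \<le> 1 / real n - 1 / real (Suc n)"
      using Suc by (simp add: divide_simps power2_eq_square)
    finally show ?case using Suc by simp
  qed simp
  with False show ?thesis by (smt (verit) gr0I of_nat_0_le_iff zero_le_divide_1_iff)
qed simp

text \<open>Induction on \<open>n\<close>: proper divisors are \<open>n div x\<close> with
  \<open>x \<ge> 2\<close>, so a large exponent \<open>B\<close> makes the sum of their
  \<open>B\<close>-th powers a small multiple of \<open>n powr B\<close>, small enough to absorb the
  denominator of the recursion.\<close>

lemma divisor_weight_polynomial_bound:
  assumes "0 < e"
  obtains B where "0 \<le> B" "\<And>n. 0 < n \<Longrightarrow> divisor_weight e n \<le> real n powr B"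
proof -
  \<comment> \<open>The largest value of \<open>1 / (1 - real n powr -e)\<close> over
    \<open>n \<ge> 2\<close>, attained at 2.\<close>
  define K where "K = 1 / (1 - 2 powr -e)"
  have two: "2 powr -e < (1::real)" using powr_minus_less_1[OF assms, of 2] by simp
  have K: "1 \<le> K" using two by (simp add: K_def divide_simps)
  \<comment> \<open>Chosen so that \<open>2 powr (2 - B) = 1 / K\<close>: the gain from
    \<open>x \<ge> 2\<close> exactly pays for the loss \<open>K\<close>, with
    \<open>x powr -2\<close> left over for convergence.\<close>
  define B where "B = 2 + log 2 K"
  have B: "2 \<le> B" using K by (simp add: B_def)
  have "divisor_weight e n \<le> real n powr B" if "0 < n" for n
    using that
  proof (induction n rule: less_induct)
    case (less n)
    show ?case
    proof (cases "n = 1")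
      case False
      with less have n: "1 < n" by simp
      have "(\<Sum>d | d dvd n \<and> d < n. real d powr -e * divisor_weight e d)
          \<le> (\<Sum>d | d dvd n \<and> d < n. real d powr B)"
      proof (rule sum_mono, clarify)
        fix d assume d: "d dvd n" "d < n"
        hence d0: "0 < d" using n by (auto intro: Nat.gr0I)
        have "real d powr -e \<le> 1" using d0 assms powr_mono[of "-e" 0 "real d"] by simp
        thus "real d powr -e * divisor_weight e d \<le> real d powr B"
          using less.IH[OF d(2) d0] divisor_weight_ge_1[OF assms d0]
            mult_mono[of "real d powr -e" 1 "divisor_weight e d" "real d powr B"] by simp
      qed
      also have "\<dots> \<le> (\<Sum>d\<in>(\<lambda>x. n div x) ` {2..n}. real d powr B)"
      proof (rule sum_mono2)
        show "{d. d dvd n \<and> d < n} \<subseteq> (\<lambda>x. n div x) ` {2..n}"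
        proof
          fix d assume "d \<in> {d. d dvd n \<and> d < n}"
          then obtain x where x: "n = d * x" "d < n" by auto
          have "0 < d" using x n by (intro Nat.gr0I) auto
          moreover have "x \<noteq> 0" "x \<noteq> 1" using x n by (auto intro!: Nat.gr0I)
          hence "2 \<le> x" by simp
          moreover have "x \<le> n" using x \<open>0 < d\<close> by simp
          ultimately have "0 < d" "x \<in> {2..n}" by auto
          with x show "d \<in> (\<lambda>x. n div x) ` {2..n}"
            by (intro image_eqI[of _ _ x]) auto
        qed
      qed auto
      also have "\<dots> \<le> (\<Sum>x=2..n. real (n div x) powr B)"
        using sum_image_le[of "{2..n}" "\<lambda>d. real d powr B" "\<lambda>x. n div x"] by (simp add: comp_def)
      also have "\<dots> \<le> (\<Sum>x=2..n. real n powr B * 2 powr (2 - B) * real x powr -2)"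
      proof (rule sum_mono)
        fix x assume x: "x \<in> {2..n}"
        have "real (n div x) powr B \<le> (real n / real x) powr B"
          using B by (intro powr_mono2 of_nat_div_le_of_nat) auto
        also have "\<dots> = real n powr B * (real x powr (2 - B) * real x powr -2)"
          using x n by (simp add: powr_divide powr_diff powr_minus_divide)
        also have "\<dots> \<le> real n powr B * (2 powr (2 - B) * real x powr -2)"
          using x B by (intro mult_left_mono mult_right_mono powr_mono2') auto
        finally show "real (n div x) powr B \<le> real n powr B * 2 powr (2 - B) * real x powr -2"
          by (simp add: mult.assoc)
      qed
      also have "\<dots> \<le> real n powr B * 2 powr (2 - B)"
        using sum_inverse_squares_le_1[of n]
        by (simp add: sum_distrib_left[symmetric] mult_left_le)
      also have "2 powr (2 - B) = 1 / K"
        using K by (simp add: B_def powr_minus_divide)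
      finally have "(1 - real n powr -e) * divisor_weight e n \<le> real n powr B * (1 - 2 powr -e)"
        using divisor_weight_proper[OF assms n] by (simp add: K_def)
      moreover have "real n powr -e \<le> 2 powr -e"
        using n assms by (intro powr_mono2') auto
      hence "(1 - 2 powr -e) * divisor_weight e n \<le> (1 - real n powr -e) * divisor_weight e n"
        using divisor_weight_ge_1[OF assms, of n] n by (intro mult_right_mono) auto
      ultimately have "(1 - 2 powr -e) * divisor_weight e n \<le> (1 - 2 powr -e) * real n powr B"
        by (simp add: mult.commute)
      thus ?thesis using two by simp
    qed simp
  qed
  with B that[of B] show thesis by simp
qed

section \<open>Dirichlet sums and mean values of the weight\<close>

lemma sum_divisors_swap:
  fixes F g :: "nat \<Rightarrow> real"
  shows "(\<Sum>d=1..M. \<Sum>x | x dvd d. F x * g d) = (\<Sum>x=1..M. F x * (\<Sum>y=1..M div x. g (x * y)))"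
proof -
  have "(\<Sum>d=1..M. \<Sum>x | x dvd d. F x * g d) = (\<Sum>d=1..M. \<Sum>x=1..M. if x dvd d then F x * g d else 0)"
  proof (rule sum.cong[OF refl])
    fix d assume d: "d \<in> {1..M}"
    have "x \<in> {1..M}" if "x dvd d" for x
      using that d dvd_imp_le[OF that] dvd_pos_nat[of d x] by auto
    thus "(\<Sum>x | x dvd d. F x * g d) = (\<Sum>x=1..M. if x dvd d then F x * g d else 0)"
      by (intro sum.mono_neutral_cong_left) auto
  qed
  also have "\<dots> = (\<Sum>x=1..M. \<Sum>d=1..M. if x dvd d then F x * g d else 0)"
    by (rule sum.swap)
  also have "\<dots> = (\<Sum>x=1..M. F x * (\<Sum>y=1..M div x. g (x * y)))"
  proof (rule sum.cong[OF refl])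
    fix x assume x: "x \<in> {1..M}"
    have im: "{1..M} \<inter> {d. x dvd d} = (\<lambda>y. x * y) ` {1..M div x}"
    proof (intro equalityI subsetI)
      fix d assume "d \<in> {1..M} \<inter> {d. x dvd d}"
      then obtain y where y: "d = x * y" "1 \<le> d" "d \<le> M" by auto
      hence "y \<in> {1..M div x}" using x by (cases "y = 0") (auto simp: less_eq_div_iff_mult_less_eq mult.commute)
      thus "d \<in> (\<lambda>y. x * y) ` {1..M div x}" using y by blast
    next
      fix d assume "d \<in> (\<lambda>y. x * y) ` {1..M div x}"
      thus "d \<in> {1..M} \<inter> {d. x dvd d}"
        using x by (auto simp: less_eq_div_iff_mult_less_eq mult.commute Suc_le_eq)
    qed
    have "(\<Sum>d=1..M. if x dvd d then F x * g d else 0) = (\<Sum>d\<in>{1..M} \<inter> {d. x dvd d}. F x * g d)"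
      by (simp add: sum.inter_restrict)
    also have "\<dots> = (\<Sum>y=1..M div x. F x * g (x * y))"
      unfolding im using x by (subst sum.reindex) (auto intro!: inj_onI)
    finally show "(\<Sum>d=1..M. if x dvd d then F x * g d else 0) = F x * (\<Sum>y=1..M div x. g (x * y))"
      by (simp add: sum_distrib_left)
  qed
  finally show ?thesis .
qed

text \<open>Unfolds each weight into its divisor sum and writes \<open>d = x * y\<close>. With
  \<open>g\<close> a negative power it shifts a Dirichlet exponent; with \<open>g = 1\<close> it
  reduces the mean value to a Dirichlet sum.\<close>

lemma divisor_weight_sum_upto:
  assumes "0 < e"
  shows "(\<Sum>d=1..M. divisor_weight e d * g d)
    = (\<Sum>x=1..M. real x powr -e * divisor_weight e x * (\<Sum>y=1..M div x. g (x * y)))"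
proof -
  have "(\<Sum>d=1..M. divisor_weight e d * g d)
      = (\<Sum>d=1..M. \<Sum>x | x dvd d. real x powr -e * divisor_weight e x * g d)"
    using divisor_weight_sum[OF assms] by (intro sum.cong refl) (simp add: sum_distrib_right[symmetric])
  also note sum_divisors_swap
  finally show ?thesis .
qed

text \<open>Uniformity in \<open>s\<close> matters: the exponent grows along the iteration below
  while the cost per step must stay the same \<open>Z\<close>.\<close>

lemma sum_powr_bounded:
  fixes e :: real
  assumes "0 < e"
  obtains Z where "1 \<le> Z" "\<And>s M. 1 + e \<le> s \<Longrightarrow> (\<Sum>y=1..M. real y powr -s) \<le> Z"
proof
  have sm: "summable (\<lambda>y. real y powr -(1 + e))"
    using assms by (subst summable_real_powr_iff) auto
  show "1 \<le> 1 + (\<Sum>y. real y powr -(1 + e))"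
    using sm by (simp add: suminf_nonneg)
  fix s M assume "1 + e \<le> s"
  hence "(\<Sum>y=1..M. real y powr -s) \<le> (\<Sum>y=1..M. real y powr -(1 + e))"
    by (intro sum_mono powr_mono) auto
  also have "\<dots> \<le> (\<Sum>y. real y powr -(1 + e))"
    using sm by (intro sum_le_suminf) auto
  finally show "(\<Sum>y=1..M. real y powr -s) \<le> 1 + (\<Sum>y. real y powr -(1 + e))" by simp
qed

text \<open>Inserting the divisor sum for the weight trades the exponent \<open>s\<close> for \<open>s + e\<close>
  at bounded cost; after finitely many steps the polynomial bound suffices.\<close>
lemma divisor_weight_dirichlet_bounded:
  assumes "0 < e"
  obtains C where "1 \<le> C" "\<And>M. (\<Sum>d=1..M. divisor_weight e d * real d powr -(1 + e)) \<le> C"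
proof -
  obtain Z where Z: "1 \<le> Z" "\<And>s M. 1 + e \<le> s \<Longrightarrow> (\<Sum>y=1..M. real y powr -s) \<le> Z"
    using sum_powr_bounded[OF assms] by blast
  obtain B where B: "0 \<le> B" "\<And>n. 0 < n \<Longrightarrow> divisor_weight e n \<le> real n powr B"
    using divisor_weight_polynomial_bound[OF assms] by blast
  define T where "T s M = (\<Sum>d=1..M. divisor_weight e d * real d powr -s)" for s M
  have step: "T s M \<le> Z * T (s + e) M" if s: "1 + e \<le> s" for s M
  proof -
    have "T s M = (\<Sum>x=1..M. real x powr -e * divisor_weight e x
        * (\<Sum>y=1..M div x. real (x * y) powr -s))"
      unfolding T_def by (rule divisor_weight_sum_upto[OF assms])
    also have "\<dots> = (\<Sum>x=1..M. divisor_weight e x * real x powr -(s + e)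
        * (\<Sum>y=1..M div x. real y powr -s))"
      by (intro sum.cong refl)
         (simp add: powr_mult sum_distrib_left powr_minus powr_diff powr_add divide_simps mult_ac)
    also have "\<dots> \<le> (\<Sum>x=1..M. divisor_weight e x * real x powr -(s + e) * Z)"
    proof (rule sum_mono, rule mult_left_mono)
      fix x assume "x \<in> {1..M}"
      thus "0 \<le> divisor_weight e x * real x powr -(s + e)"
        using divisor_weight_ge_1[OF assms, of x] by auto
    qed (rule Z(2)[OF s])
    also have "\<dots> = Z * T (s + e) M"
      by (simp add: T_def sum_distrib_left mult_ac)
    finally show ?thesis .
  qed
  have iter: "T (1 + e) M \<le> Z ^ n * T (1 + e + real n * e) M" for n M
  proof (induction n)
    case (Suc n)
    have "Z ^ n * T (1 + e + real n * e) M \<le> Z ^ n * (Z * T (1 + e + real n * e + e) M)"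
      using Z(1) assms by (intro mult_left_mono step) auto
    with Suc show ?case by (simp add: algebra_simps)
  qed simp
  \<comment> \<open>After \<open>n\<close> shifts the exponent exceeds \<open>1 + e + B\<close>, so
    the polynomial bound leaves an exponent above \<open>1 + e\<close>.\<close>
  obtain n where n: "B < real n * e"
    using reals_Archimedean3[OF assms] by blast
  have "T (1 + e + real n * e) M \<le> Z" for M
  proof -
    have "T (1 + e + real n * e) M \<le> (\<Sum>d=1..M. real d powr -(1 + e + real n * e - B))"
      unfolding T_def
    proof (rule sum_mono)
      fix d assume "d \<in> {1..M}"
      hence "divisor_weight e d * real d powr -(1 + e + real n * e)
          \<le> real d powr B * real d powr -(1 + e + real n * e)"
        by (intro mult_right_mono B(2)) auto
      also have "\<dots> = real d powr -(1 + e + real n * e - B)"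
        by (simp add: powr_add[symmetric] algebra_simps)
      finally show "divisor_weight e d * real d powr -(1 + e + real n * e)
          \<le> real d powr -(1 + e + real n * e - B)" .
    qed
    also have "\<dots> \<le> Z" using n by (intro Z(2)) auto
    finally show ?thesis .
  qed
  with iter[of _ n] Z(1) have "T (1 + e) M \<le> Z ^ n * Z" for M
    by (smt (verit) mult_left_mono zero_le_power)
  moreover have "1 \<le> Z ^ n * Z"
    using one_le_power[OF Z(1), of "Suc n"] by (simp add: mult.commute)
  ultimately show thesis using that[of "Z ^ n * Z"] by (simp add: T_def)
qed

text \<open>Each \<open>x\<close> has at most \<open>M / x\<close> multiples up to \<open>M\<close>,
  and the extra factor \<open>1 / x\<close> turns the exponent \<open>e\<close> into
  \<open>1 + e\<close>.\<close>

lemma divisor_weight_mean_bounded: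
  assumes "0 < e"
  obtains C where "1 \<le> C" "\<And>M. (\<Sum>m=1..M. divisor_weight e m) \<le> C * real M"
proof -
  obtain C where C: "1 \<le> C" "\<And>M. (\<Sum>d=1..M. divisor_weight e d * real d powr -(1 + e)) \<le> C"
    using divisor_weight_dirichlet_bounded[OF assms] by blast
  have "(\<Sum>m=1..M. divisor_weight e m) \<le> C * real M" for M
  proof -
    have "(\<Sum>m=1..M. divisor_weight e m)
        = (\<Sum>x=1..M. real x powr -e * divisor_weight e x * real (M div x))"
      using divisor_weight_sum_upto[OF assms, of "\<lambda>_. 1" M] by simp
    also have "\<dots> \<le> (\<Sum>x=1..M. divisor_weight e x * real x powr -(1 + e) * real M)"
    proof (rule sum_mono)
      fix x assume x: "x \<in> {1..M}"
      have "real x powr -e * divisor_weight e x * real (M div x)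
          \<le> real x powr -e * divisor_weight e x * (real M / real x)"
        using x divisor_weight_ge_1[OF assms, of x]
        by (intro mult_left_mono of_nat_div_le_of_nat) auto
      also have "\<dots> = divisor_weight e x * real x powr -(1 + e) * real M"
        using x by (simp add: powr_diff powr_minus divide_simps powr_add)
      finally show "real x powr -e * divisor_weight e x * real (M div x)
          \<le> divisor_weight e x * real x powr -(1 + e) * real M" .
    qed
    also have "\<dots> \<le> C * real M"
      using C(2)[of M] by (simp add: sum_distrib_right[symmetric] mult_right_mono)
    finally show ?thesis .
  qed
  with C(1) that show thesis by blast
qed

section \<open>Weighted sums over multiples\<close>

text \<open>For \<open>b = d * m\<close>, submultiplicativity splits off the weight of
  \<open>d\<close>; the power \<open>r \<le> 1\<close> of the weight of \<open>m\<close> is at most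
  the weight itself, as that is at least 1, and the mean value over \<open>m \<le> Y / d\<close>
  applies.\<close>

lemma divisor_weight_powr_multiples:
  fixes A :: "int set"
  assumes e: "0 < e" and C: "\<And>M. (\<Sum>m=1..M. divisor_weight e m) \<le> C * real M" "0 \<le> C"
    and A: "\<And>a. a \<in> A \<Longrightarrow> 1 \<le> a \<and> real_of_int a \<le> Y" and Y: "0 \<le> Y" and d: "0 < d"
    and r: "0 \<le> r" "r \<le> 1"
  shows "(\<Sum>b | b \<in> A \<and> int d dvd b. divisor_weight e (nat b) powr r)
    \<le> C * Y / real d * divisor_weight e d powr r"
proof -
  define M where "M = nat \<lfloor>Y / real d\<rfloor>"
  let ?B = "{b. b \<in> A \<and> int d dvd b}"
  let ?q = "\<lambda>b. nat b div d"
  have B: "nat b = d * ?q b \<and> ?q b \<in> {1..M}" if b: "b \<in> ?B" for b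
  proof -
    from b obtain c where c: "b = int d * c" by auto
    have "0 < int d * c" using A[of b] b c by auto
    hence c0: "0 < c" using d by (simp add: zero_less_mult_iff)
    have q: "?q b = nat c" using c d c0 by (simp add: nat_mult_distrib)
    have "real_of_int c \<le> Y / real d"
      using A[of b] b c d by (simp add: field_simps)
    hence "nat c \<le> M" unfolding M_def using c0 by (intro nat_mono) (simp add: le_floor_iff)
    thus ?thesis using q c c0 by (simp add: nat_mult_distrib)
  qed
  have inj: "inj_on ?q ?B"
  proof (rule inj_onI)
    fix x y assume xy: "x \<in> ?B" "y \<in> ?B" "?q x = ?q y"
    hence "nat x = nat y" using B[of x] B[of y] by metis
    thus "x = y" using A[of x] A[of y] xy by auto
  qed
  have W: "1 \<le> divisor_weight e m" if "0 < m" for m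
    using divisor_weight_ge_1[OF e that] .
  have "(\<Sum>b\<in>?B. divisor_weight e (nat b) powr r)
      \<le> (\<Sum>b\<in>?B. divisor_weight e d powr r * divisor_weight e (?q b))"
  proof (rule sum_mono)
    fix b assume b: "b \<in> ?B"
    let ?m = "?q b"
    have m: "nat b = d * ?m" "0 < ?m" using B[OF b] by auto
    have "divisor_weight e (nat b) powr r \<le> (divisor_weight e d * divisor_weight e ?m) powr r"
      using divisor_weight_mult_le[OF e d m(2)] W[of "nat b"] A[of b] b r
      by (intro powr_mono2) (auto simp flip: m(1))
    also have "\<dots> = divisor_weight e d powr r * divisor_weight e ?m powr r"
      using W[OF d] W[OF m(2)] by (simp add: powr_mult)
    also have "\<dots> \<le> divisor_weight e d powr r * divisor_weight e ?m"
      using powr_mono[OF r(2) W[OF m(2)]] W[OF m(2)] by (intro mult_left_mono) auto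
    finally show "divisor_weight e (nat b) powr r \<le> divisor_weight e d powr r * divisor_weight e ?m" .
  qed
  also have "\<dots> = divisor_weight e d powr r * (\<Sum>m\<in>?q ` ?B. divisor_weight e m)"
    using inj by (simp add: sum.reindex sum_distrib_left)
  also have "\<dots> \<le> divisor_weight e d powr r * (\<Sum>m=1..M. divisor_weight e m)"
  proof (rule mult_left_mono[OF sum_mono2])
    show "?q ` ?B \<subseteq> {1..M}" using B by blast
    show "0 \<le> divisor_weight e m" if "m \<in> {1..M} - ?q ` ?B" for m
      using W[of m] that by auto
  qed auto
  also have "\<dots> \<le> divisor_weight e d powr r * (C * real M)"
    by (intro mult_left_mono C) auto
  also have "\<dots> \<le> divisor_weight e d powr r * (C * (Y / real d))"
    using C(2) Y by (intro mult_left_mono) (auto simp: M_def of_nat_floor)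
  finally show ?thesis by (simp add: mult_ac)
qed

section \<open>The multilinear Schur test\<close>

text \<open>After normalising each \<open>v i\<close> by \<open>B i\<close>, the geometric mean at
  every point is the constant \<open>(1 / P) powr (1 / k)\<close>; AM-GM summed over
  \<open>E\<close> bounds \<open>card E\<close> times this constant by 1.\<close>

lemma card_power_le_prod:
  fixes v :: "'i \<Rightarrow> 'a \<Rightarrow> real"
  assumes "finite E" "finite I" "I \<noteq> {}"
    and v: "\<And>i a. i \<in> I \<Longrightarrow> a \<in> E \<Longrightarrow> 0 \<le> v i a"
    and one: "\<And>a. a \<in> E \<Longrightarrow> (\<Prod>i\<in>I. v i a) = 1"
    and B: "\<And>i. i \<in> I \<Longrightarrow> 0 < B i" "\<And>i. i \<in> I \<Longrightarrow> (\<Sum>a\<in>E. v i a) \<le> B i"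
  shows "real (card E) ^ card I \<le> (\<Prod>i\<in>I. B i)"
proof -
  define P where "P = (\<Prod>i\<in>I. B i)"
  define k where "k = card I"
  have P: "0 < P" using B(1) by (auto simp: P_def intro!: prod_pos)
  have k: "0 < k" using assms by (simp add: k_def card_gt_0_iff)
  have "(1 / P) powr (1 / k) \<le> (\<Sum>i\<in>I. v i a / B i / k)" if a: "a \<in> E" for a
    using arith_geom_mean[OF assms(2,3), of "\<lambda>i. v i a / B i"] v[OF _ a] B(1) one[OF a]
    by (simp add: prod_dividef P_def k_def less_imp_le)
  hence "(\<Sum>a\<in>E. (1 / P) powr (1 / k)) \<le> (\<Sum>a\<in>E. \<Sum>i\<in>I. v i a / B i / k)"
    by (rule sum_mono)
  also have "\<dots> = (\<Sum>i\<in>I. (\<Sum>a\<in>E. v i a) / B i / k)"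
    by (subst sum.swap) (simp add: sum_divide_distrib)
  also have "\<dots> \<le> (\<Sum>i\<in>I. 1 / k)"
    using B by (intro sum_mono divide_right_mono) (simp_all add: divide_le_eq)
  also have "\<dots> = 1" using k by (simp add: k_def)
  finally have "real (card E) * (1 / P) powr (1 / k) \<le> 1" by simp
  hence "real (card E) \<le> P powr (1 / k)"
    using P by (simp add: powr_divide divide_le_eq)
  hence "real (card E) ^ k \<le> (P powr (1 / k)) ^ k"
    by (intro power_mono) auto
  also have "\<dots> = P" using P k by (simp add: powr_realpow[symmetric] powr_powr)
  finally show ?thesis by (simp add: P_def k_def)
qed

lemma weighted_gcd_tuples_le:
  fixes A :: "'i \<Rightarrow> int set" and Y :: "'i \<Rightarrow> real"
  assumes e: "0 < e" "e \<le> 1"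
    and C: "\<And>M. (\<Sum>m=1..M. divisor_weight e m) \<le> C * real M" "0 \<le> C"
    and I: "finite I" "i \<in> I" "card I = Suc n" "0 < n"
    and A: "\<And>j a. j \<in> I \<Longrightarrow> a \<in> A j \<Longrightarrow> 1 \<le> a \<and> real_of_int a \<le> Y j"
    and fin: "\<And>j. j \<in> I \<Longrightarrow> finite (A j)" and Y: "\<And>j. j \<in> I \<Longrightarrow> 0 \<le> Y j"
    and D: "1 \<le> D"
  shows "(\<Sum>a | a \<in> PiE I A \<and> D \<le> real_of_int (Gcd (a ` I)).
      \<Prod>j\<in>I. if j = i then 1 / divisor_weight e (nat (a j))
             else divisor_weight e (nat (a j)) powr (1 / n))
    \<le> D powr (e - real n) * C ^ n * (\<Prod>j\<in>I - {i}. Y j) * card (A i)"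
proof -
  define W where "W = divisor_weight e"
  \<comment> \<open>Multiplying \<open>d powr -n\<close> from the other coordinates by
    \<open>d powr s\<close> leaves \<open>d powr -e\<close>, the factor in the divisor sum. It is
    nonnegative because \<open>e \<le> 1 \<le> n\<close>.\<close>
  define s where "s = real n - e"
  \<comment> \<open>A cutoff for the common divisors: the gcd divides the \<open>i\<close>-th entry,
    which is at most \<open>Y i\<close>.\<close>
  define L where "L = nat \<lfloor>Y i\<rfloor>"
  define v where "v j b = (if j = i then 1 / W (nat b) else W (nat b) powr (1 / n))" for j b
  \<comment> \<open>Putting the divisibility test into each factor makes the sum over tuples factor
    over coordinates.\<close>
  define f where "f d j b = (if int d dvd b then v j b else 0)" for d j b
  have W: "1 \<le> W m" if "0 < m" for m
    using divisor_weight_ge_1[OF e(1) that] by (simp add: W_def)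
  have v0: "0 \<le> v j b" if "j \<in> I" "b \<in> A j" for j b
    using W[of "nat b"] A[OF that] by (auto simp: v_def)
  have f0: "0 \<le> f d j b" if "j \<in> I" "b \<in> A j" for d j b
    using v0[OF that] by (simp add: f_def)
  have s: "0 \<le> s" using I e by (simp add: s_def)
  have finP: "finite (PiE I A)" using I fin by (intro finite_PiE) auto
  let ?E = "{a. a \<in> PiE I A \<and> D \<le> real_of_int (Gcd (a ` I))}"
  have "(\<Sum>a\<in>?E. \<Prod>j\<in>I. v j (a j)) \<le> (\<Sum>a\<in>?E. \<Sum>d=1..L. (d / D) powr s * (\<Prod>j\<in>I. f d j (a j)))"
  proof (rule sum_mono)
    fix a assume a: "a \<in> ?E"
    hence aA: "a j \<in> A j" if "j \<in> I" for j using that by auto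
    define g where "g = nat (Gcd (a ` I))"
    have "1 \<le> Gcd (a ` I)" using a D by auto
    hence g: "1 \<le> g" "int g = Gcd (a ` I)" by (auto simp: g_def)
    have dv: "int g dvd a j" if "j \<in> I" for j using that by (simp add: g)
    have gD: "D \<le> real g"
      using a by (metis (mono_tags, lifting) g(2) mem_Collect_eq of_int_of_nat_eq)
    have "int g \<le> a i" using dv[OF I(2)] A[OF I(2) aA[OF I(2)]] by (intro zdvd_imp_le) auto
    hence "real g \<le> Y i" using A[OF I(2) aA[OF I(2)]] by linarith
    hence gL: "g \<in> {1..L}" using g(1) by (simp add: L_def le_nat_floor)
    \<comment> \<open>Only the term \<open>d = g\<close> of the divisor sum is needed; the others
      are nonnegative.\<close>
    have "(\<Prod>j\<in>I. v j (a j)) \<le> (g / D) powr s * (\<Prod>j\<in>I. v j (a j))"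
    proof -
      have "1 \<le> (g / D) powr s" using gD D s by (intro ge_one_powr_ge_zero) auto
      moreover have "0 \<le> (\<Prod>j\<in>I. v j (a j))" using v0 aA by (intro prod_nonneg) auto
      ultimately show ?thesis by (simp add: mult_le_cancel_right1)
    qed
    also have "\<dots> = (g / D) powr s * (\<Prod>j\<in>I. f g j (a j))"
      using dv by (simp add: f_def)
    also have "\<dots> \<le> (\<Sum>d=1..L. (d / D) powr s * (\<Prod>j\<in>I. f d j (a j)))"
      using gL f0 aA by (intro member_le_sum) (auto intro!: mult_nonneg_nonneg prod_nonneg)
    finally show "(\<Prod>j\<in>I. v j (a j)) \<le> (\<Sum>d=1..L. (d / D) powr s * (\<Prod>j\<in>I. f d j (a j)))" .
  qed
  \<comment> \<open>Dropping the gcd condition leaves a full product set, over which the sum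
    factors.\<close>
  also have "\<dots> \<le> (\<Sum>a\<in>PiE I A. \<Sum>d=1..L. (d / D) powr s * (\<Prod>j\<in>I. f d j (a j)))"
    using finP f0
    by (intro sum_mono2) (auto intro!: sum_nonneg mult_nonneg_nonneg prod_nonneg simp: PiE_mem)
  also have "\<dots> = (\<Sum>d=1..L. (d / D) powr s * (\<Prod>j\<in>I. \<Sum>b\<in>A j. f d j b))"
    using I fin by (subst sum.swap) (simp add: prod_sum_PiE sum_distrib_left)
  also have "\<dots> \<le> (\<Sum>d=1..L. D powr -s * C ^ n * (\<Prod>j\<in>I - {i}. Y j)
      * (\<Sum>b\<in>A i. if int d dvd b then real d powr -e * W d / W (nat b) else 0))"
  proof (rule sum_mono)
    fix d assume "d \<in> {1..L}"
    hence d: "0 < d" by auto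
    have "(\<Prod>j\<in>I - {i}. \<Sum>b\<in>A j. f d j b) \<le> (\<Prod>j\<in>I - {i}. C * Y j / d * W d powr (1 / n))"
    proof (rule prod_mono, intro conjI)
      fix j assume j: "j \<in> I - {i}"
      show "0 \<le> (\<Sum>b\<in>A j. f d j b)" using j f0 by (intro sum_nonneg) auto
      have "(\<Sum>b\<in>A j. f d j b) = (\<Sum>b | b \<in> A j \<and> int d dvd b. W (nat b) powr (1 / n))"
        using j fin[of j] unfolding f_def v_def
        by (intro sum.mono_neutral_cong_right) auto
      also have "\<dots> \<le> C * Y j / d * W d powr (1 / n)"
        unfolding W_def using j A Y I(4)
        by (intro divisor_weight_powr_multiples[OF e(1) C _ _ d]) auto
      finally show "(\<Sum>b\<in>A j. f d j b) \<le> C * Y j / d * W d powr (1 / n)" .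
    qed
    also have "\<dots> = (\<Prod>j\<in>I - {i}. Y j) * (C / d * W d powr (1 / n)) ^ n"
    proof -
      have "card (I - {i}) = n" using I by simp
      thus ?thesis
        by (simp add: prod.distrib prod_dividef power_mult_distrib power_divide)
    qed
    also have "(C / d * W d powr (1 / n)) ^ n = C ^ n * real d powr - real n * W d"
      using d W[OF d] I(4)
      by (simp add: power_mult_distrib power_divide powr_realpow[symmetric] powr_powr powr_minus divide_simps)
    finally have rest: "(\<Prod>j\<in>I - {i}. \<Sum>b\<in>A j. f d j b)
      \<le> (\<Prod>j\<in>I - {i}. Y j) * (C ^ n * real d powr - real n * W d)" .
    have "(d / D) powr s * (\<Prod>j\<in>I. \<Sum>b\<in>A j. f d j b)
       = (d / D) powr s * ((\<Sum>b\<in>A i. f d i b) * (\<Prod>j\<in>I - {i}. \<Sum>b\<in>A j. f d j b))"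
      using I by (subst prod.remove[of I i]) auto
    also have "\<dots> \<le> (d / D) powr s * ((\<Sum>b\<in>A i. f d i b) *
        ((\<Prod>j\<in>I - {i}. Y j) * (C ^ n * real d powr - real n * W d)))"
      using rest f0 I by (intro mult_left_mono) (auto intro!: sum_nonneg)
    also have "\<dots> = D powr -s * C ^ n * (\<Prod>j\<in>I - {i}. Y j)
        * ((real d powr s * real d powr - real n * W d) * (\<Sum>b\<in>A i. f d i b))"
      using D d by (simp add: powr_divide powr_minus divide_simps)
    also have "real d powr s * real d powr - real n = real d powr -e"
      by (simp add: powr_add[symmetric] s_def)
    also have "real d powr -e * W d * (\<Sum>b\<in>A i. f d i b)
        = (\<Sum>b\<in>A i. if int d dvd b then real d powr -e * W d / W (nat b) else 0)"
      unfolding sum_distrib_left by (intro sum.cong refl) (simp add: f_def v_def)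
    finally show "(d / D) powr s * (\<Prod>j\<in>I. \<Sum>b\<in>A j. f d j b) \<le> D powr -s * C ^ n * (\<Prod>j\<in>I - {i}. Y j)
      * (\<Sum>b\<in>A i. if int d dvd b then real d powr -e * W d / W (nat b) else 0)" .
  qed
  also have "\<dots> = D powr -s * C ^ n * (\<Prod>j\<in>I - {i}. Y j)
      * (\<Sum>b\<in>A i. \<Sum>d=1..L. if int d dvd b then real d powr -e * W d / W (nat b) else 0)"
    by (subst sum.swap) (simp add: sum_distrib_left)
  \<comment> \<open>For fixed \<open>b\<close>, the sum over divisors of \<open>b\<close> is at most
    the full divisor sum \<open>W (nat b)\<close>, which the weight \<open>1 / W (nat b)\<close>
    cancels.\<close>
  also have "\<dots> \<le> D powr -s * C ^ n * (\<Prod>j\<in>I - {i}. Y j) * (\<Sum>b\<in>A i. 1)"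
  proof (intro mult_left_mono sum_mono)
    fix b assume b: "b \<in> A i"
    hence b0: "0 < nat b" "1 \<le> b" using A[OF I(2) b] by auto
    have "(\<Sum>d=1..L. if int d dvd b then real d powr -e * W d / W (nat b) else 0)
        = (\<Sum>d\<in>{1..L} \<inter> {d. int d dvd b}. real d powr -e * W d / W (nat b))"
      by (simp add: sum.inter_restrict)
    also have "\<dots> \<le> (\<Sum>d | d dvd nat b. real d powr -e * W d / W (nat b))"
    proof (rule sum_mono2)
      show "finite {d. d dvd nat b}" using b0 by simp
      show "{1..L} \<inter> {d. int d dvd b} \<subseteq> {d. d dvd nat b}"
        using b0 int_dvd_int_iff[of _ "nat b"] by auto
      fix d assume "d \<in> {d. d dvd nat b} - {1..L} \<inter> {d. int d dvd b}"
      hence "0 < d" using b0 dvd_pos_nat[of "nat b" d] by simp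
      thus "0 \<le> real d powr -e * W d / W (nat b)" using W[of d] W[OF b0(1)] by simp
    qed
    also have "\<dots> = 1"
      using divisor_weight_sum[OF e(1) b0(1)] W[OF b0(1)]
      by (simp add: W_def sum_divide_distrib[symmetric])
    finally show "(\<Sum>d=1..L. if int d dvd b then real d powr -e * W d / W (nat b) else 0) \<le> 1" .
  next
    show "0 \<le> D powr -s * C ^ n * (\<Prod>j\<in>I - {i}. Y j)"
      using C(2) Y by (intro mult_nonneg_nonneg prod_nonneg) auto
  qed
  finally show ?thesis by (simp add: v_def W_def s_def cong: if_cong)
qed

text \<open>Each \<open>Y j\<close> occurs once for every \<open>i\<close> other than
  \<open>j\<close>.\<close>

lemma prod_prod_remove:
  fixes Y :: "'i \<Rightarrow> 'a :: comm_semiring_1"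
  assumes "finite I"
  shows "(\<Prod>i\<in>I. \<Prod>j\<in>I - {i}. Y j) = (\<Prod>j\<in>I. Y j) ^ (card I - 1)"
proof -
  have "(\<Prod>i\<in>I. \<Prod>j\<in>I - {i}. Y j) = (\<Prod>i\<in>I. \<Prod>j | j \<in> I \<and> i \<noteq> j. Y j)"
    by (intro prod.cong) auto
  also have "\<dots> = (\<Prod>j\<in>I. \<Prod>i | i \<in> I \<and> i \<noteq> j. Y j)"
    by (rule prod.swap_restrict[OF assms assms])
  also have "\<dots> = (\<Prod>j\<in>I. Y j ^ (card I - 1))"
  proof (rule prod.cong[OF refl])
    fix j assume "j \<in> I"
    moreover have "{i. i \<in> I \<and> i \<noteq> j} = I - {j}" by auto
    ultimately show "(\<Prod>i | i \<in> I \<and> i \<noteq> j. Y j) = Y j ^ (card I - 1)"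
      using assms by simp
  qed
  finally show ?thesis by (simp add: prod_power_distrib)
qed

lemma card_gcd_tuples_power_le:
  fixes A :: "'i \<Rightarrow> int set" and Y :: "'i \<Rightarrow> real"
  assumes e: "0 < e" "e \<le> 1"
    and C: "\<And>M. (\<Sum>m=1..M. divisor_weight e m) \<le> C * real M" "0 < C"
    and I: "finite I" "card I = Suc n" "0 < n"
    and A: "\<And>j a. j \<in> I \<Longrightarrow> a \<in> A j \<Longrightarrow> 1 \<le> a \<and> real_of_int a \<le> Y j"
    and fin: "\<And>j. j \<in> I \<Longrightarrow> finite (A j)" and ne: "\<And>j. j \<in> I \<Longrightarrow> A j \<noteq> {}"
    and Y: "\<And>j. j \<in> I \<Longrightarrow> 0 < Y j" and D: "1 \<le> D"
  shows "real (card {a \<in> PiE I A. D \<le> real_of_int (Gcd (a ` I))}) ^ Suc n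
    \<le> (D powr (e - n) * C ^ n) ^ Suc n * (\<Prod>j\<in>I. Y j) ^ n * (\<Prod>j\<in>I. real (card (A j)))"
proof -
  let ?E = "{a \<in> PiE I A. D \<le> real_of_int (Gcd (a ` I))}"
  define W where "W = divisor_weight e"
  define v where "v i a = (\<Prod>j\<in>I. if j = i then 1 / W (nat (a j)) else W (nat (a j)) powr (1 / n))"
    for i and a :: "'i \<Rightarrow> int"
  define B where "B i = D powr (e - n) * C ^ n * (\<Prod>j\<in>I - {i}. Y j) * card (A i)" for i
  have W: "1 \<le> W m" if "0 < m" for m
    using divisor_weight_ge_1[OF e(1) that] by (simp add: W_def)
  have "real (card ?E) ^ card I \<le> (\<Prod>i\<in>I. B i)"
  proof (rule card_power_le_prod[where v = v])
    have "finite (PiE I A)" using I fin by (intro finite_PiE) auto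
    thus "finite ?E" by simp
    show "I \<noteq> {}" using I by auto
    show "0 \<le> v i a" if "i \<in> I" "a \<in> ?E" for i a
    proof -
      have "0 \<le> W (nat (a j))" if "j \<in> I" for j
        using W[of "nat (a j)"] A[OF that, of "a j"] that \<open>a \<in> ?E\<close> by (auto simp: PiE_mem)
      thus ?thesis unfolding v_def by (intro prod_nonneg) auto
    qed
    show "(\<Prod>i\<in>I. v i a) = 1" if a: "a \<in> ?E" for a
    proof -
      \<comment> \<open>The entry at \<open>j\<close> gets \<open>1 / W\<close> once, for
        \<open>i = j\<close>, and \<open>W powr (1 / n)\<close> from each of the \<open>n\<close>
        other \<open>i\<close>.\<close>
      have "(\<Prod>i\<in>I. if j = i then 1 / W (nat (a j)) else W (nat (a j)) powr (1 / n)) = 1"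
        if j: "j \<in> I" for j
      proof -
        have w: "1 \<le> W (nat (a j))"
          using A[OF j, of "a j"] j a by (intro W) (auto simp: PiE_mem)
        have "(\<Prod>i\<in>I - {j}. if j = i then 1 / W (nat (a j)) else W (nat (a j)) powr (1 / n))
            = (\<Prod>i\<in>I - {j}. W (nat (a j)) powr (1 / n))"
          by (intro prod.cong) auto
        also have "\<dots> = (W (nat (a j)) powr (1 / n)) ^ n" using I j by simp
        also have "\<dots> = W (nat (a j))"
          using w I by (simp add: powr_realpow[symmetric] powr_powr)
        finally show ?thesis using w I j by (subst prod.remove[of I j]) auto
      qed
      thus ?thesis unfolding v_def by (subst prod.swap) simp
    qed
    show "0 < B i" if i: "i \<in> I" for i
      unfolding B_def using C D Y fin[OF i] ne[OF i]
      by (intro mult_pos_pos prod_pos) (auto simp: card_gt_0_iff)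
    show "(\<Sum>a\<in>?E. v i a) \<le> B i" if i: "i \<in> I" for i
      unfolding v_def B_def W_def
      by (rule weighted_gcd_tuples_le) (use e C I A fin Y D i in \<open>auto intro: less_imp_le\<close>)
  qed (use I in auto)
  also have "(\<Prod>i\<in>I. B i)
      = (D powr (e - n) * C ^ n) ^ Suc n * (\<Prod>j\<in>I. Y j) ^ n * (\<Prod>j\<in>I. real (card (A j)))"
    using I by (simp add: B_def prod.distrib prod_prod_remove del: power_Suc)
  finally show ?thesis using I by simp
qed

section \<open>Choice of exponent and passage from tuples to cardinalities\<close>

theorem theorem1p3:
  fixes k :: nat and \<epsilon> :: real
  assumes "k \<ge> 2" and "0 < \<epsilon>" and "\<epsilon> < 1"
  shows "\<exists>C::real. C > 0 \<and>
    (\<forall>(X :: nat \<Rightarrow> real) (D :: real) (\<delta> :: real) (A :: nat \<Rightarrow> int set).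
      (\<forall>i\<in>{1..k}. 1 \<le> X i) \<longrightarrow> 1 \<le> D \<longrightarrow> D \<le> Min (X ` {1..k}) \<longrightarrow>
      0 < \<delta> \<longrightarrow> \<delta> \<le> 1 \<longrightarrow>
      (\<forall>i\<in>{1..k}. \<forall>a\<in>A i. X i \<le> real_of_int a \<and> real_of_int a \<le> 2 * X i) \<longrightarrow>
      real (card {a \<in> (\<Pi>\<^sub>E i\<in>{1..k}. A i). real_of_int (Gcd (a ` {1..k})) \<ge> D})
        \<ge> \<delta> * (\<Prod>i\<in>{1..k}. real (card (A i))) \<longrightarrow>
      (\<Prod>i\<in>{1..k}. real (card (A i)))
        \<le> C * \<delta> powr (- (real k / (real k - 1))) * ((\<Prod>i\<in>{1..k}. X i) / D powr (real k - \<epsilon>)))"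
proof -
  define n where "n = k - 1"
  have n: "0 < n" "k = Suc n" using assms(1) by (auto simp: n_def)
  \<comment> \<open>Makes \<open>k * (e - n) = n * (\<epsilon> - k)\<close>, so the power of
    \<open>D\<close> becomes the \<open>n\<close>-th power of
    \<open>1 / D powr (k - \<epsilon>)\<close>.\<close>
  define e where "e = \<epsilon> * n / k"
  have e: "0 < e" "e \<le> 1"
    using assms n mult_mono[of \<epsilon> 1 "real n" "real k"] by (auto simp: e_def divide_le_eq)
  have en: "k * (e - n) = n * (\<epsilon> - k)"
    using n by (simp add: e_def field_simps)
  obtain C where C: "1 \<le> C" "\<And>M. (\<Sum>m=1..M. divisor_weight e m) \<le> C * real M"
    using divisor_weight_mean_bounded[OF e(1)] by blast
  show ?thesis
  \<comment> \<open>Each coordinate costs \<open>C\<close> from the mean value and 2 from the upper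
    end \<open>2 * X i\<close> of its interval.\<close>
  proof (intro exI[of _ "(2 * C) ^ k"] conjI allI impI)
    show "0 < (2 * C) ^ k" using C by simp
  next
    fix X :: "nat \<Rightarrow> real" and D \<delta> :: real and A :: "nat \<Rightarrow> int set"
    assume X: "\<forall>i\<in>{1..k}. 1 \<le> X i" and D: "1 \<le> D" and \<delta>: "0 < \<delta>"
      and A: "\<forall>i\<in>{1..k}. \<forall>a\<in>A i. X i \<le> real_of_int a \<and> real_of_int a \<le> 2 * X i"
      and many: "real (card {a \<in> (\<Pi>\<^sub>E i\<in>{1..k}. A i). real_of_int (Gcd (a ` {1..k})) \<ge> D})
        \<ge> \<delta> * (\<Prod>i\<in>{1..k}. real (card (A i)))"
    define N where "N = (\<Prod>i\<in>{1..k}. real (card (A i)))"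
    define P where "P = (\<Prod>i\<in>{1..k}. X i)"
    have P: "0 < P" unfolding P_def using X by (intro prod_pos) force
    define R where "R = (2 * C) ^ k * (P / D powr (k - \<epsilon>))"
    have R: "0 < R" using P C D by (simp add: R_def)
    have "N \<le> \<delta> powr (- (k / n)) * R"
    proof (cases "N = 0")
      case False
      moreover have "0 \<le> N" unfolding N_def by (intro prod_nonneg) simp
      ultimately have N: "0 < N" by simp
      have A1: "1 \<le> a \<and> real_of_int a \<le> 2 * X j" if "j \<in> {1..k}" "a \<in> A j" for j a
      proof -
        have "1 \<le> X j" "X j \<le> real_of_int a" "real_of_int a \<le> 2 * X j" using X A that by auto
        thus ?thesis by linarith
      qed
      \<comment> \<open>A nonzero \<open>card\<close> gives both properties, since infinite sets
        have \<open>card\<close> 0.\<close>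
      have ne: "A j \<noteq> {} \<and> finite (A j)" if "j \<in> {1..k}" for j
      proof -
        have "real (card (A j)) \<noteq> 0"
          using False that unfolding N_def by (metis prod_zero finite_atLeastAtMost)
        thus ?thesis by (simp add: card_eq_0_iff)
      qed
      have "(\<delta> * N) ^ k \<le> real (card {a \<in> PiE {1..k} A. D \<le> real_of_int (Gcd (a ` {1..k}))}) ^ k"
        using many \<delta> N by (intro power_mono) (auto simp: N_def)
      also have "\<dots> \<le> (D powr (e - n) * C ^ n) ^ k * (\<Prod>j\<in>{1..k}. 2 * X j) ^ n * N"
      proof -
        have "0 < 2 * X j" if "j \<in> {1..k}" for j using X that by force
        thus ?thesis
          using card_gcd_tuples_power_le[of e C "{1..k}" n A "\<lambda>j. 2 * X j" D] e C D A1 ne n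
          by (simp add: N_def)
      qed
      also have "\<dots> = R ^ n * N"
      proof -
        have "(D powr (e - n)) ^ k = (1 / D powr (k - \<epsilon>)) ^ n"
          using D en by (simp add: powr_realpow[symmetric] powr_powr powr_minus_divide[symmetric] mult.commute)
        moreover have "(\<Prod>j\<in>{1..k}. 2 * X j) = 2 ^ k * P"
          by (simp add: prod.distrib P_def)
        ultimately show ?thesis
          by (simp add: R_def power_mult_distrib power_divide power_mult[symmetric] mult_ac)
      qed
      \<comment> \<open>Splitting off one factor \<open>N\<close> matches the right-hand side; after
        cancelling it, an \<open>n\<close>-th root remains, whence the exponent \<open>k / n\<close>
        of \<delta>.\<close>
      also have "(\<delta> * N) ^ k = (\<delta> powr (k / n) * N) ^ n * N"
      proof -
        have "(\<delta> powr (k / n)) ^ n = \<delta> ^ k"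
          using \<delta> n(1) by (simp add: powr_realpow[symmetric] powr_powr)
        thus ?thesis by (simp add: power_mult_distrib n(2))
      qed
      finally have "(\<delta> powr (k / n) * N) ^ n \<le> R ^ n" using N by simp
      hence "\<delta> powr (k / n) * N \<le> R"
        using R n(1) by (simp add: power_mono_iff N less_imp_le)
      thus ?thesis using \<delta> by (simp add: powr_minus field_simps)
    qed (use R in simp)
    thus "(\<Prod>i\<in>{1..k}. real (card (A i)))
        \<le> (2 * C) ^ k * \<delta> powr (- (real k / (real k - 1))) * ((\<Prod>i\<in>{1..k}. X i) / D powr (real k - \<epsilon>))"
      using n by (simp add: N_def P_def R_def mult_ac)
  qed
qed

end
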